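(* Let $\mathbb{X},\mathbb{Y},\mathbb{E}$ be finite-dimensional Euclidean spaces, let $\Phi:\mathbb{X}\to\mathbb{E}$ and $K:\mathbb{X}\to\mathbb{Y}$ be linear operators, and let $g:\mathbb{Y}\to\mathbb{R}\cup\{\infty\}$ be a proper lower semicontinuous convex function. For $(b,\mu)\in\mathbb{E}\times(0,\infty)$ define $$S_{LS}(b,\mu):=\Big\{x\in\mathbb{X}\;\Big|\;0\in\tfrac{1}{\mu}\Phi^*(\Phi x-b)+K^*\partial g(Kx)\Big\}.$$ Let $(\bar b,\bar\mu)\in\mathbb{E}\times(0,\infty)$, let $\bar x\in S_{LS}(\bar b,\bar\mu)$, and let $\bar y\in\partial g(K\bar x)$ satisfy $K^*\bar y=-\frac{1}{\bar\mu}\Phi^*(\Phi\bar x-\bar b)$. Assume that the Robinson constraint qualification $0\in\mathrm{int}\,(K\bar x+\mathrm{Im}\,K-\mathrm{dom}\,g)$ holds. Then: (a) If $S_{LS}$ has the isolated calmness property at $(\bar b,\bar\mu)$ for $\bar x$, then $$\mathrm{Ker}\,\Phi\cap K^{-1}\big(T_{\partial g^*(\bar y)\cap\mathrm{Im}\,K}(K\bar x)\big)=\{0\}.$$ (b) If, additionally, $g$ satisfies the quadratic growth condition at $K\bar x$ for $\bar y$, then $S_{LS}$ has the isolated calmness property at $(\bar b,\bar\mu)$ for $\bar x$ provided that $$\mathrm{Ker}\,\Phi\cap K^{-1}\big(T_{\partial g^*(\bar y)}(K\bar x)\big)=\{0\}.\qquad(\star)$$ (c) Consequently (with $g$ satisfying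 the quadratic growth condition at $K\bar x$ for $\bar y$), condition $(\star)$ is necessary and sufficient for the isolated calmness of $S_{LS}$ at $(\bar b,\bar\mu)$ for $\bar x$ if one of the following two conditions is true: (i) the set $\partial g^*(\bar y)$ is polyhedral; (ii) $\mathrm{Im}\,K\cap\mathrm{ri}\,(\partial g^*(\bar y))\neq\emptyset$, where $\mathrm{ri}$ denotes the relative interior.
   Context: $g^*$ is the Fenchel conjugate of $g$, $\partial$ the convex subdifferential, $K^*$ the adjoint. Tangent cone: for a set $\Omega$ and $\bar u\in\Omega$, $T_\Omega(\bar u):=\{w\mid\exists\,t_k\downarrow0,\ w_k\to w,\ \bar u+t_kw_k\in\Omega\}$. Isolated calmness: $S_{LS}$ is isolated calm at $(\bar b,\bar\mu)$ for $\bar x\in S_{LS}(\bar b,\bar\mu)$ if there exist $\kappa>0$ and neighborhoods $U$ of $\bar x$, $V$ of $\bar b$, and $M\subset(0,\infty)$ of $\bar\mu$ such that $\|x-\bar x\|\le\kappa(\|b-\bar b\|+|\mu-\bar\mu|)$ whenever $(b,\mu)\in V\times M$ and $x\in S_{LS}(b,\mu)\cap U$. Quadratic growth condition: a proper lower semicontinuous convex function $\varphi$ satisfies it at $\bar u\in\mathrm{dom}\,\varphi$ for $\bar v\in\partial\varphi(\bar u)$ if there exist $c,\varepsilon>0$ such that $\varphi(u)\ge\varphi(\bar u)+\langle\bar v,u-\bar u\rangle+\frac c2[d(u;(\partial\varphi)^{-1}(\bar v))]^2$ for all $u$ with $\|u-\bar u\|<\varepsilon$, where $d(\cdot;\Omega)$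 is the distance to $\Omega$ and $(\partial\varphi)^{-1}(\bar v)=\{u\mid\bar v\in\partial\varphi(u)\}$. *)

theory Defs
  imports "HOL-Analysis.Analysis"
begin

definition eff_dom :: "('a \<Rightarrow> ereal) \<Rightarrow> 'a set" where
  "eff_dom f = {x. f x < \<infinity>}"

definition proper_fun :: "('a \<Rightarrow> ereal) \<Rightarrow> bool" where
  "proper_fun f \<longleftrightarrow> (\<forall>x. f x \<noteq> -\<infinity>) \<and> eff_dom f \<noteq> {}"

definition lower_semicontinuous :: "('a::topological_space \<Rightarrow> ereal) \<Rightarrow> bool" where
  "lower_semicontinuous f \<longleftrightarrow> (\<forall>x. f x \<le> Liminf (at x) f)"

text \<open>Used only for functions that never take the value \<open>-\<infinity>\<close>, so no sum of opposite
  infinities occurs on the right-hand side.\<close>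

definition convex_fun :: "('a::real_vector \<Rightarrow> ereal) \<Rightarrow> bool" where
  "convex_fun f \<longleftrightarrow>
    (\<forall>x y t. 0 < t \<longrightarrow> t < 1 \<longrightarrow>
      f ((1 - t) *\<^sub>R x + t *\<^sub>R y) \<le> ereal (1 - t) * f x + ereal t * f y)"

definition fenchel_conjugate :: "('a::real_inner \<Rightarrow> ereal) \<Rightarrow> 'a \<Rightarrow> ereal" where
  "fenchel_conjugate f v = (SUP u. ereal (v \<bullet> u) - f u)"

text \<open>Empty at every point where \<open>f\<close> is not finite.\<close>

definition subdifferential :: "('a::real_inner \<Rightarrow> ereal) \<Rightarrow> 'a \<Rightarrow> 'a set" where
  "subdifferential f u =
    {v. \<bar>f u\<bar> \<noteq> \<infinity> \<and> (\<forall>z. f z \<ge> f u + ereal (v \<bullet> (z - u)))}"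

definition tangent_cone :: "'a::real_normed_vector set \<Rightarrow> 'a \<Rightarrow> 'a set" where
  "tangent_cone \<Omega> u =
    {w. \<exists>t :: nat \<Rightarrow> real. \<exists>ws :: nat \<Rightarrow> 'a.
          (\<forall>k. t k > 0) \<and> t \<longlonglongrightarrow> 0 \<and> ws \<longlonglongrightarrow> w \<and> (\<forall>k. u + t k *\<^sub>R ws k \<in> \<Omega>)}"

definition S_LS ::
  "('x::euclidean_space \<Rightarrow> 'e::euclidean_space) \<Rightarrow> ('x \<Rightarrow> 'y::euclidean_space) \<Rightarrow>
   ('y \<Rightarrow> ereal) \<Rightarrow> 'e \<Rightarrow> real \<Rightarrow> 'x set" where
  "S_LS \<Phi> K g b \<mu> =
    {x. 0 \<in> (\<lambda>y. (1 / \<mu>) *\<^sub>R adjoint \<Phi> (\<Phi> x - b) + adjoint K y) ` subdifferential g (K x)}"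

definition isolated_calm ::
  "('e::real_normed_vector \<Rightarrow> real \<Rightarrow> 'x::real_normed_vector set) \<Rightarrow> 'e \<Rightarrow> real \<Rightarrow> 'x \<Rightarrow> bool" where
  "isolated_calm S b0 \<mu>0 x0 \<longleftrightarrow>
    x0 \<in> S b0 \<mu>0 \<and>
    (\<exists>\<kappa>>0. \<exists>U V M. open U \<and> x0 \<in> U \<and> open V \<and> b0 \<in> V \<and>
        open M \<and> \<mu>0 \<in> M \<and> M \<subseteq> {0<..} \<and>
        (\<forall>b\<in>V. \<forall>\<mu>\<in>M. \<forall>x \<in> S b \<mu> \<inter> U.
            norm (x - x0) \<le> \<kappa> * (norm (b - b0) + \<bar>\<mu> - \<mu>0\<bar>)))"

text \<open>The set whose distance is taken contains \<open>u0\<close>, so the library convention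
  \<open>infdist u {} = 0\<close> plays no role.\<close>

definition quadratic_growth :: "('a::euclidean_space \<Rightarrow> ereal) \<Rightarrow> 'a \<Rightarrow> 'a \<Rightarrow> bool" where
  "quadratic_growth f u0 v0 \<longleftrightarrow>
    u0 \<in> eff_dom f \<and> v0 \<in> subdifferential f u0 \<and>
    (\<exists>c>0. \<exists>\<epsilon>>0. \<forall>u. norm (u - u0) < \<epsilon> \<longrightarrow>
        f u \<ge> f u0 + ereal (v0 \<bullet> (u - u0) + c / 2 * (infdist u {u. v0 \<in> subdifferential f u})\<^sup>2))"

end

theory Submission
  imports Defs
begin

text \<open>Let \<open>C\<close> be the set of points at which \<open>ybar\<close> is a subgradient of \<open>g\<close>. By Fenchel duality
  \<open>C\<close> is the subdifferential of the conjugate at \<open>ybar\<close>, so all three claims are about \<open>C\<close>.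

  Necessity: moving \<open>xbar\<close> in directions \<open>w\<^sub>k \<rightarrow> w\<close> along which \<open>K x\<close> stays in \<open>C\<close> gives
  solutions of the problems in which \<open>bbar\<close> is shifted by the corresponding multiples
  of \<open>\<Phi> w\<^sub>k\<close>. If \<open>\<Phi> w = 0\<close>, the solution moves at first order while the data move only at higher
  order, which isolated calmness forbids unless \<open>w = 0\<close>. The moving points \<open>K x\<close> lie in the range of \<open>K\<close>, so only the tangent cone of
  \<open>C \<inter> range K\<close> is reached: \<open>isolated_calm_imp_kernel_trivial\<close>.

  Sufficiency: two estimates are composed. Monotonicity of the subdifferential together with
  quadratic growth bounds both residuals, \<open>norm (\<Phi> (x - xbar))\<close> and the distance of \<open>K x\<close> to \<open>C\<close>,
  near \<open>xbar\<close>, by a multiple of the perturbation of the data (\<open>S_LS_residual_bound\<close>). The tangent cone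
  condition bounds \<open>norm (x - xbar)\<close> by a multiple of the two residuals, by compactness of the unit
  sphere (\<open>error_bound_of_tangent_cone\<close>).

  Equivalence: when \<open>C\<close> is polyhedral, or its relative interior meets the range of \<open>K\<close>, every
  vector of \<open>range K\<close> tangent to \<open>C\<close> is tangent to \<open>C \<inter> range K\<close>, so the necessary and the
  sufficient condition coincide.\<close>

section \<open>Fenchel duality\<close>

lemma fenchel_conjugate_le_iff:
  fixes g :: "'a::real_inner \<Rightarrow> ereal"
  assumes "\<And>x. g x \<noteq> -\<infinity>"
  shows "fenchel_conjugate g y \<le> ereal m \<longleftrightarrow> (\<forall>x r. g x \<le> ereal r \<longrightarrow> y \<bullet> x - r \<le> m)"
proof -
  have "ereal (y \<bullet> x) - g x \<le> ereal m \<longleftrightarrow> (\<forall>r. g x \<le> ereal r \<longrightarrow> y \<bullet> x - r \<le> m)" for x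
  proof (cases "g x")
    case (real a)
    have "y \<bullet> x - a \<le> m \<longleftrightarrow> (\<forall>r. a \<le> r \<longrightarrow> y \<bullet> x - r \<le> m)" by (auto intro: order_trans)
    then show ?thesis by (simp add: real)
  qed (use assms[of x] in auto)
  then show ?thesis
    unfolding fenchel_conjugate_def SUP_le_iff by auto
qed

lemma closed_epigraph:
  fixes g :: "'a::metric_space \<Rightarrow> ereal"
  assumes "lower_semicontinuous g"
  shows "closed {(x, r). g x \<le> ereal r}"
  unfolding closed_sequential_limits
proof (intro allI impI, elim conjE)
  fix f :: "nat \<Rightarrow> 'a \<times> real" and l
  assume mem: "\<forall>n. f n \<in> {(x, r). g x \<le> ereal r}" and lim: "f \<longlonglongrightarrow> l"
  obtain x r where l: "l = (x, r)" by (cases l)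
  have fx: "(\<lambda>n. fst (f n)) \<longlonglongrightarrow> x" and fr: "(\<lambda>n. snd (f n)) \<longlonglongrightarrow> r"
    using tendsto_fst[OF lim] tendsto_snd[OF lim] by (auto simp: l)
  have "g x \<le> ereal r"
  proof (rule ccontr)
    assume "\<not> g x \<le> ereal r"
    then obtain q where q: "ereal r < ereal q" "ereal q < g x"
      using ereal_dense2[of "ereal r" "g x"] by (metis not_le)
    have "eventually (\<lambda>z. ereal q < g z) (at x)"
      using q(2) assms by (simp add: lower_semicontinuous_def le_Liminf_iff)
    then have "eventually (\<lambda>z. ereal q < g z) (nhds x)"
      using q(2) by (auto simp: eventually_at_filter elim: eventually_mono)
    then have "eventually (\<lambda>n. ereal q < g (fst (f n))) sequentially"
      using fx by (auto simp: filterlim_iff)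
    moreover have "g (fst (f n)) \<le> ereal (snd (f n))" for n
      using mem[rule_format, of n] by (auto simp: case_prod_beta)
    ultimately have "eventually (\<lambda>n. q \<le> snd (f n)) sequentially"
      by (elim eventually_mono) (metis less_le_trans less_ereal.simps(1) less_imp_le)
    then have "q \<le> r"
      by (rule tendsto_lowerbound[OF fr]) simp
    with q(1) show False by simp
  qed
  then show "l \<in> {(x, r). g x \<le> ereal r}" by (simp add: l)
qed

lemma convex_epigraph:
  fixes g :: "'a::real_vector \<Rightarrow> ereal"
  assumes "convex_fun g"
  shows "convex {(x, r). g x \<le> ereal r}"
proof -
  have "g ((1 - t) *\<^sub>R x + t *\<^sub>R y) \<le> ereal ((1 - t) * r + t * s)"
    if xr: "g x \<le> ereal r" and ys: "g y \<le> ereal s" and t: "0 \<le> t" "t \<le> 1"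
    for x y :: 'a and r s t :: real
  proof -
    consider "t = 0" | "t = 1" | "0 < t" "t < 1" using t by linarith
    then show ?thesis
    proof cases
      case 3
      have "g ((1 - t) *\<^sub>R x + t *\<^sub>R y) \<le> ereal (1 - t) * g x + ereal t * g y"
        using assms 3 by (auto simp: convex_fun_def)
      also have "\<dots> \<le> ereal (1 - t) * ereal r + ereal t * ereal s"
        using 3 xr ys by (intro add_mono ereal_mult_left_mono) auto
      finally show ?thesis by simp
    qed (use xr ys in auto)
  qed
  then show ?thesis by (auto simp: convex_alt)
qed

text \<open>If the Fenchel-Young equality failed at \<open>(u, y)\<close>, the point \<open>(u, u \<bullet> y - g* y)\<close> would lie
  below the closed convex epigraph of \<open>g\<close>, and a separating hyperplane \<open>(p, s)\<close> would exist with
  \<open>s \<ge> 0\<close>. For \<open>s > 0\<close> it gives an affine minorant of \<open>g\<close> with slope \<open>- p / s\<close>, and the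
  subgradient inequality of \<open>g*\<close> fails at that slope. A vertical hyperplane, \<open>s = 0\<close>, separates
  \<open>u\<close> from the domain of \<open>g\<close>, and then the inequality fails at \<open>y - p\<close>.\<close>

lemma subdifferential_fenchel_conjugate_imp:
  fixes g :: "'a::euclidean_space \<Rightarrow> ereal"
  assumes "proper_fun g" "lower_semicontinuous g" "convex_fun g"
    and u: "u \<in> subdifferential (fenchel_conjugate g) y"
  shows "y \<in> subdifferential g u"
proof -
  have nmi: "g x \<noteq> -\<infinity>" for x using assms(1) by (auto simp: proper_fun_def)
  obtain m where m: "fenchel_conjugate g y = ereal m"
    using u by (auto simp: subdifferential_def)
  have sub: "ereal (m + u \<bullet> (z - y)) \<le> fenchel_conjugate g z" for z
    using u m by (auto simp: subdifferential_def)
  have my: "y \<bullet> x - r \<le> m" if "g x \<le> ereal r" for x r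
    using fenchel_conjugate_le_iff[of g y m] nmi m that by auto
  let ?E = "{(x, r). g x \<le> ereal r}"
  have young: "g u \<le> ereal (u \<bullet> y - m)"
  proof (rule ccontr)
    assume "\<not> g u \<le> ereal (u \<bullet> y - m)"
    then have "(u, u \<bullet> y - m) \<notin> ?E" by simp
    from separating_hyperplane_closed_point[OF convex_epigraph[OF assms(3)]
        closed_epigraph[OF assms(2)] this]
    obtain a \<beta> where a: "a \<bullet> (u, u \<bullet> y - m) < \<beta>" and E: "\<forall>e\<in>?E. \<beta> < a \<bullet> e" by blast
    obtain p s where ps: "a = (p, s)" by (cases a)
    have below: "p \<bullet> u + s * (u \<bullet> y - m) < \<beta>" using a by (simp add: ps)
    have above: "\<beta> < p \<bullet> x + s * r" if "g x \<le> ereal r" for x r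
      using E that by (auto simp: ps)
    obtain x0 r0 where x0: "g x0 \<le> ereal r0"
    proof -
      obtain x0 where "g x0 < \<infinity>" using assms(1) by (auto simp: proper_fun_def eff_dom_def)
      then show thesis using nmi[of x0] that[of x0] by (cases "g x0") auto
    qed
    have "s \<ge> 0"
    proof (rule ccontr)
      assume "\<not> s \<ge> 0"
      \<comment> \<open>The epigraph is unbounded upwards, so a negative \<open>s\<close> would violate the separation.\<close>
      define R where "R = max r0 ((\<beta> - p \<bullet> x0) / s)"
      have "g x0 \<le> ereal R" using x0 by (rule order_trans) (simp add: R_def)
      from above[OF this] have "\<beta> - p \<bullet> x0 < s * R" by simp
      moreover have "s * R \<le> s * ((\<beta> - p \<bullet> x0) / s)"
        using \<open>\<not> s \<ge> 0\<close> by (intro mult_left_mono_neg) (auto simp: R_def)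
      ultimately show False using \<open>\<not> s \<ge> 0\<close> by simp
    qed
    then consider "s > 0" | "s = 0" by linarith
    then show False
    proof cases
      case 1
      define q where "q = - (p /\<^sub>R s)"
      have "q \<bullet> x - r \<le> - \<beta> / s" if "g x \<le> ereal r" for x r
      proof -
        have "\<beta> / s \<le> (p \<bullet> x + s * r) / s"
          using above[OF that] 1 by (intro divide_right_mono) auto
        also have "\<dots> = r - q \<bullet> x" using 1 by (simp add: q_def field_simps)
        finally show ?thesis by simp
      qed
      then have "fenchel_conjugate g q \<le> ereal (- \<beta> / s)"
        by (simp add: fenchel_conjugate_le_iff[OF nmi])
      with sub[of q] have "m + u \<bullet> (q - y) \<le> - \<beta> / s"
        by (metis ereal_less_eq(3) order_trans)
      then have "s * (m + u \<bullet> (q - y)) \<le> - \<beta>"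
        using 1 by (simp add: field_simps)
      moreover have "s * (m + u \<bullet> (q - y)) = - (p \<bullet> u) - s * (u \<bullet> y - m)"
        using 1 by (simp add: q_def inner_diff_right inner_commute algebra_simps)
      ultimately show False using below by simp
    next
      case 2
      have "(y - p) \<bullet> x - r \<le> m - \<beta>" if "g x \<le> ereal r" for x r
        using above[OF that] my[OF that] 2 by (simp add: inner_diff_left)
      then have "fenchel_conjugate g (y - p) \<le> ereal (m - \<beta>)"
        by (simp add: fenchel_conjugate_le_iff[OF nmi])
      with sub[of "y - p"] have "m + u \<bullet> (y - p - y) \<le> m - \<beta>"
        by (metis ereal_less_eq(3) order_trans)
      then show False using below 2 by (simp add: inner_commute)
    qed
  qed
  obtain gu where gu: "g u = ereal gu" using young nmi[of u] by (cases "g u") auto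
  have "g u + ereal (y \<bullet> (z - u)) \<le> g z" for z
  proof (cases "g z")
    case (real r)
    have "y \<bullet> z - r \<le> m" using my[of z r] real by simp
    moreover have "gu \<le> u \<bullet> y - m" using young gu by simp
    ultimately show ?thesis by (simp add: gu real inner_diff_right inner_commute)
  qed (use nmi[of z] in auto)
  then show ?thesis by (auto simp: subdifferential_def gu)
qed

lemma subdifferential_imp_fenchel_conjugate:
  fixes g :: "'a::euclidean_space \<Rightarrow> ereal"
  assumes "proper_fun g" and y: "y \<in> subdifferential g u"
  shows "u \<in> subdifferential (fenchel_conjugate g) y"
proof -
  have nmi: "g x \<noteq> -\<infinity>" for x using assms(1) by (auto simp: proper_fun_def)
  obtain r where r: "g u = ereal r" using y by (auto simp: subdifferential_def)
  have ge: "ereal (z \<bullet> u - r) \<le> fenchel_conjugate g z" for z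
    unfolding fenchel_conjugate_def by (rule SUP_upper2[of u]) (auto simp: r)
  have "y \<bullet> x - s \<le> y \<bullet> u - r" if "g x \<le> ereal s" for x s
  proof -
    have "g u + ereal (y \<bullet> (x - u)) \<le> ereal s"
      using y that by (auto simp: subdifferential_def intro: order_trans)
    then show ?thesis by (simp add: r inner_diff_right)
  qed
  then have "fenchel_conjugate g y \<le> ereal (y \<bullet> u - r)"
    by (simp add: fenchel_conjugate_le_iff[OF nmi])
  with ge[of y] have eq: "fenchel_conjugate g y = ereal (y \<bullet> u - r)" by (rule antisym[rotated])
  have "ereal (y \<bullet> u - r) + ereal (u \<bullet> (z - y)) \<le> fenchel_conjugate g z" for z
    using ge[of z] by (simp add: inner_diff_right inner_commute)
  then show ?thesis by (auto simp: subdifferential_def eq)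
qed

lemma subdifferential_fenchel_conjugate:
  fixes g :: "'a::euclidean_space \<Rightarrow> ereal"
  assumes "proper_fun g" "lower_semicontinuous g" "convex_fun g"
  shows "subdifferential (fenchel_conjugate g) y = {u. y \<in> subdifferential g u}"
  using subdifferential_fenchel_conjugate_imp[OF assms] subdifferential_imp_fenchel_conjugate[OF assms(1)]
  by blast

lemma convex_subdifferential: "convex (subdifferential f u)"
proof (cases "\<bar>f u\<bar> = \<infinity>")
  case False
  then obtain r where r: "f u = ereal r" by auto
  have eq: "subdifferential f u = (\<Inter>z. {v. f u + ereal (v \<bullet> (z - u)) \<le> f z})"
    using False by (auto simp: subdifferential_def)
  have "convex {v. f u + ereal (v \<bullet> (z - u)) \<le> f z}" for z
  proof (cases "f z")
    case (real s)
    have "{v. f u + ereal (v \<bullet> (z - u)) \<le> f z} = {v. (z - u) \<bullet> v \<le> s - r}"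
      by (auto simp: r real inner_commute)
    then show ?thesis by (simp add: convex_halfspace_le)
  qed (simp_all add: r)
  then show ?thesis unfolding eq by (intro convex_INT) auto
qed (simp add: subdifferential_def)

section \<open>Tangent cones\<close>

lemma tangent_cone_mono: "S \<subseteq> T \<Longrightarrow> tangent_cone S u \<subseteq> tangent_cone T u"
  unfolding tangent_cone_def by blast

lemma zero_in_tangent_cone:
  assumes "u \<in> S"
  shows "0 \<in> tangent_cone S u"
  using assms LIMSEQ_inverse_real_of_nat unfolding tangent_cone_def
  by (intro CollectI exI[of _ "\<lambda>k. inverse (real (Suc k))"] exI[of _ "\<lambda>_. 0"]) simp

text \<open>A polyhedron is cut out by finitely many half-spaces. Those active at \<open>u\<close> are respected by
  every tangent direction for all step lengths, and the inactive ones for short steps; so every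
  tangent direction is feasible, and the step stays in the subspace.\<close>

lemma tangent_cone_polyhedron_Int_subspace:
  fixes C :: "'a::euclidean_space set"
  assumes C: "polyhedron C" and S: "subspace S" and u: "u \<in> C" "u \<in> S"
  shows "tangent_cone C u \<inter> S \<subseteq> tangent_cone (C \<inter> S) u"
proof
  fix v assume v: "v \<in> tangent_cone C u \<inter> S"
  then obtain t ws where t: "\<And>k::nat. t k > (0::real)" "t \<longlonglongrightarrow> 0"
    and ws: "ws \<longlonglongrightarrow> v" "\<And>k. u + t k *\<^sub>R ws k \<in> C"
    unfolding tangent_cone_def by blast
  obtain F where F: "finite F" "C = \<Inter>F"
    and half: "\<And>h. h \<in> F \<Longrightarrow> \<exists>a b. a \<noteq> 0 \<and> h = {x. a \<bullet> x \<le> b}"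
    using C unfolding polyhedron_def by metis
  have ev: "eventually (\<lambda>k. u + t k *\<^sub>R v \<in> h) sequentially" if h: "h \<in> F" for h
  proof -
    obtain a b where ab: "h = {x. a \<bullet> x \<le> b}" using half[OF h] by blast
    have ub: "a \<bullet> u \<le> b" using u(1) F(2) h ab by blast
    show ?thesis
    proof (cases "a \<bullet> u = b")
      case True
      have "a \<bullet> ws k \<le> 0" for k
      proof -
        have "u + t k *\<^sub>R ws k \<in> h" using ws(2) F(2) h by blast
        then have "t k * (a \<bullet> ws k) \<le> 0" using True by (simp add: ab inner_add_right)
        then show ?thesis using t(1)[of k] by (simp add: mult_le_0_iff)
      qed
      then have "a \<bullet> v \<le> 0"
        by (intro LIMSEQ_le_const2[OF tendsto_inner[OF tendsto_const ws(1)]]) auto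
      then have "t k * (a \<bullet> v) \<le> 0" for k
        using t(1)[of k] by (simp add: mult_le_0_iff)
      then show ?thesis using True by (simp add: ab inner_add_right)
    next
      case False
      have "(\<lambda>k. a \<bullet> (u + t k *\<^sub>R v)) \<longlonglongrightarrow> a \<bullet> (u + 0 *\<^sub>R v)"
        by (intro tendsto_intros t)
      then have "eventually (\<lambda>k. a \<bullet> (u + t k *\<^sub>R v) < b) sequentially"
        using False ub by (intro order_tendstoD(2)) auto
      then show ?thesis by (auto simp: ab elim: eventually_mono)
    qed
  qed
  have "eventually (\<lambda>k. \<forall>h\<in>F. u + t k *\<^sub>R v \<in> h) sequentially"
    using ev F(1) by (simp add: eventually_ball_finite)
  then obtain N where N: "\<And>k. k \<ge> N \<Longrightarrow> \<forall>h\<in>F. u + t k *\<^sub>R v \<in> h"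
    unfolding eventually_sequentially by blast
  have "u + t (k + N) *\<^sub>R v \<in> C \<inter> S" for k
    using N[of "k + N"] F(2) v u(2) S by (auto intro: subspace_add subspace_mul)
  then show "v \<in> tangent_cone (C \<inter> S) u"
    unfolding tangent_cone_def using t LIMSEQ_ignore_initial_segment[OF t(2), of N]
    by (intro CollectI exI[of _ "\<lambda>k. t (k + N)"] exI[of _ "\<lambda>_. v"]) auto
qed

text \<open>Let \<open>u + t\<^sub>k w\<^sub>k \<in> C\<close> with \<open>w\<^sub>k \<rightarrow> v \<in> S\<close>. The error \<open>v - w\<^sub>k\<close>, which is what may take
  the point out of \<open>S\<close>, is parallel to the affine hull of \<open>C\<close>. It can therefore be compensated by
  mixing in, with a weight \<open>e\<^sub>k t\<^sub>k\<close> where \<open>e\<^sub>k \<rightarrow> 0\<close>, a point near \<open>z\<close>: all points of the affine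
  hull near \<open>z\<close> belong to \<open>C\<close>. The mixture lies in \<open>C\<close> by convexity, lies in \<open>S\<close> by
  construction, and still has \<open>v\<close> as limiting direction.\<close>

lemma tangent_cone_rel_interior_Int_subspace:
  fixes C :: "'a::euclidean_space set"
  assumes C: "convex C" and S: "subspace S" and u: "u \<in> C" "u \<in> S"
    and z: "z \<in> S" "z \<in> rel_interior C"
  shows "tangent_cone C u \<inter> S \<subseteq> tangent_cone (C \<inter> S) u"
proof
  fix v assume v: "v \<in> tangent_cone C u \<inter> S"
  then obtain t ws where t: "\<And>k::nat. t k > (0::real)" "t \<longlonglongrightarrow> 0"
    and ws: "ws \<longlonglongrightarrow> v" "\<And>k. u + t k *\<^sub>R ws k \<in> C"
    unfolding tangent_cone_def by blast
  obtain r where r: "r > 0" "ball z r \<inter> affine hull C \<subseteq> C" and zC: "z \<in> C"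
    using z(2) by (auto simp: mem_rel_interior_ball)
  define L where "L = (\<lambda>x. x - u) ` (affine hull C)"
  have L: "subspace L"
    unfolding L_def using u(1) by (intro affine_diffs_subspace_subtract affine_affine_hull hull_inc)
  have CL: "x - u \<in> L" if "x \<in> C" for x
    using that hull_inc[of x C affine] by (auto simp: L_def)
  have wsL: "ws k \<in> L" for k
  proof -
    have "t k *\<^sub>R ws k \<in> L" using CL[OF ws(2)[of k]] by simp
    then have "(1 / t k) *\<^sub>R (t k *\<^sub>R ws k) \<in> L" by (rule subspace_mul[OF L])
    then show ?thesis using t(1)[of k] by simp
  qed
  have vL: "v \<in> L"
    using closed_sequentially[OF closed_subspace[OF L]] wsL ws(1) by blast
  \<comment> \<open>The factor \<open>2 / r\<close> keeps the compensating displacement below the radius \<open>r\<close>; the summand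
    \<open>t k\<close> keeps the weight positive when \<open>ws k = v\<close>.\<close>
  define e where "e k = (norm (v - ws k) + t k) * (2 / r)" for k
  have epos: "e k > 0" for k using t(1)[of k] r(1) by (simp add: e_def add_nonneg_pos)
  have elim: "e \<longlonglongrightarrow> 0"
  proof -
    have "(\<lambda>k. (norm (v - ws k) + t k) * (2 / r)) \<longlonglongrightarrow> (norm (v - v) + 0) * (2 / r)"
      by (intro tendsto_intros ws t)
    then show ?thesis by (simp add: e_def[abs_def])
  qed
  have etlim: "(\<lambda>k. e k * t k) \<longlonglongrightarrow> 0" using tendsto_mult[OF elim t(2)] by simp
  define ds where "ds k = (1 - e k * t k) *\<^sub>R v + e k *\<^sub>R (z - u)" for k
  have dslim: "ds \<longlonglongrightarrow> v"
  proof -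
    have "(\<lambda>k. (1 - e k * t k) *\<^sub>R v + e k *\<^sub>R (z - u)) \<longlonglongrightarrow> (1 - 0) *\<^sub>R v + 0 *\<^sub>R (z - u)"
      by (intro tendsto_intros elim etlim)
    then show ?thesis by (simp add: ds_def[abs_def])
  qed
  have dsS: "u + t k *\<^sub>R ds k \<in> S" for k
    unfolding ds_def using v u(2) z(1) S by (auto intro!: subspace_add subspace_mul subspace_diff)
  obtain N where N: "\<And>k. k \<ge> N \<Longrightarrow> e k * t k < 1"
    using order_tendstoD(2)[OF etlim, of 1] by (auto simp: eventually_sequentially)
  have dsC: "u + t k *\<^sub>R ds k \<in> C" if "k \<ge> N" for k
  proof -
    define l where "l = e k * t k"
    have l: "0 < l" "l < 1" using epos[of k] t(1)[of k] N[OF that] by (auto simp: l_def)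
    define d where "d = ((1 - l) / e k) *\<^sub>R (v - ws k)"
    have "norm d \<le> norm (v - ws k) / e k"
    proof -
      have "norm d = (1 - l) * (norm (v - ws k) / e k)" using l epos[of k] by (simp add: d_def)
      also have "\<dots> \<le> 1 * (norm (v - ws k) / e k)"
        using l epos[of k] by (intro mult_right_mono) auto
      finally show ?thesis by simp
    qed
    also have "\<dots> \<le> r / 2"
      using epos[of k] r(1) t(1)[of k] by (simp add: e_def field_simps)
    also have "\<dots> < r" using r(1) by simp
    finally have "z + d \<in> ball z r" by (simp add: dist_norm)
    moreover have "z + d \<in> affine hull C"
    proof -
      have "(z - u) + d \<in> L"
        unfolding d_def using CL[OF zC] vL wsL L by (auto intro!: subspace_add subspace_mul subspace_diff)
      then obtain x where "x \<in> affine hull C" "(z - u) + d = x - u" by (auto simp: L_def)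
      then show ?thesis by (metis add_diff_cancel_right' diff_add_cancel add.commute add.assoc diff_add_eq)
    qed
    ultimately have "z + d \<in> C" using r(2) by blast
    then have "(1 - l) *\<^sub>R (u + t k *\<^sub>R ws k) + l *\<^sub>R (z + d) \<in> C"
      using C ws(2) l by (auto simp: convex_alt)
    moreover have "l *\<^sub>R d = ((1 - l) * t k) *\<^sub>R (v - ws k)"
      using epos[of k] by (simp add: d_def l_def)
    then have "(1 - l) *\<^sub>R (u + t k *\<^sub>R ws k) + l *\<^sub>R (z + d) = u + t k *\<^sub>R ds k"
      by (simp add: scaleR_add_right) (simp add: ds_def l_def algebra_simps)
    ultimately show ?thesis by simp
  qed
  have mem: "u + t (k + N) *\<^sub>R ds (k + N) \<in> C \<inter> S" for k
    using dsS dsC by simp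
  show "v \<in> tangent_cone (C \<inter> S) u"
    unfolding tangent_cone_def
    using t(1) LIMSEQ_ignore_initial_segment[OF t(2), of N]
      LIMSEQ_ignore_initial_segment[OF dslim, of N] mem
    by (intro CollectI exI[of _ "\<lambda>k. t (k + N)"] exI[of _ "\<lambda>k. ds (k + N)"]) auto
qed

section \<open>A local error bound\<close>

text \<open>The tangency condition says that, to first order at \<open>x0\<close>, the system \<open>\<Phi> (x - x0) = 0\<close>,
  \<open>K x \<in> C\<close> has only the solution \<open>x0\<close>. Since the unit sphere is compact, normalised violations
  of the bound would accumulate at a unit vector in the forbidden cone.\<close>

lemma error_bound_of_tangent_cone:
  fixes \<Phi> :: "'x::euclidean_space \<Rightarrow> 'e::euclidean_space" and K :: "'x \<Rightarrow> 'y::euclidean_space"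
  assumes \<Phi>: "linear \<Phi>" and K: "linear K" and C: "K x0 \<in> C"
    and ker: "{x. \<Phi> x = 0} \<inter> K -` tangent_cone C (K x0) \<subseteq> {0}"
  obtains \<kappa> \<rho> where "\<kappa> > 0" "\<rho> > 0"
    "\<And>x. norm (x - x0) < \<rho> \<Longrightarrow> norm (x - x0) \<le> \<kappa> * (norm (\<Phi> (x - x0)) + infdist (K x) C)"
proof -
  let ?R = "\<lambda>x. norm (\<Phi> (x - x0)) + infdist (K x) C"
  have R0: "?R x \<ge> 0" for x by (simp add: infdist_nonneg)
  have "\<exists>n. \<forall>x. norm (x - x0) < 1 / real (Suc n) \<longrightarrow> norm (x - x0) \<le> real (Suc n) * ?R x"
  proof (rule ccontr)
    assume "\<not> ?thesis"
    then have "\<forall>n. \<exists>x. norm (x - x0) < 1 / real (Suc n) \<and> real (Suc n) * ?R x < norm (x - x0)"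
      by (meson not_le)
    then obtain x where x: "\<And>n. norm (x n - x0) < 1 / real (Suc n)"
      "\<And>n. real (Suc n) * ?R (x n) < norm (x n - x0)"
      by metis
    define t where "t n = norm (x n - x0)" for n
    have tpos: "t n > 0" for n
      using x(2)[of n] R0[of "x n"] unfolding t_def by (smt (verit) mult_nonneg_nonneg of_nat_0_le_iff)
    have inv0: "(\<lambda>n. 1 / real (Suc n)) \<longlonglongrightarrow> 0"
      using LIMSEQ_inverse_real_of_nat by (simp add: inverse_eq_divide)
    have tlim: "t \<longlonglongrightarrow> 0"
      by (rule tendsto_sandwich[OF _ _ tendsto_const inv0])
        (use x(1) tpos in \<open>auto simp: t_def less_imp_le intro!: always_eventually\<close>)
    define d where "d n = (1 / t n) *\<^sub>R (x n - x0)" for n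
    have xd: "x n = x0 + t n *\<^sub>R d n" for n using tpos[of n] by (simp add: d_def)
    have "d n \<in> sphere 0 1" for n using tpos[of n] by (simp add: d_def t_def)
    then obtain w s where w: "w \<in> sphere 0 1" and s: "strict_mono (s :: nat \<Rightarrow> nat)"
      and dw: "(d \<circ> s) \<longlonglongrightarrow> w"
      using compact_sphere[of 0 "1::real"] unfolding compact_def by metis
    have bound: "?R (x n) < t n * (1 / real (Suc n))" for n
      using x(2)[of n] by (simp add: t_def field_simps)
    have \<Phi>d: "norm (\<Phi> (d n)) \<le> 1 / real (Suc n)" for n
    proof -
      have "t n * norm (\<Phi> (d n)) = norm (\<Phi> (x n - x0))"
        using tpos[of n] by (simp add: xd linear_scale[OF \<Phi>])
      also have "\<dots> \<le> t n * (1 / real (Suc n))"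
        using bound[of n] infdist_nonneg[of "K (x n)" C] by linarith
      finally show ?thesis using tpos[of n] by (simp only: mult_le_cancel_left_pos)
    qed
    have invs: "(\<lambda>n. 1 / real (Suc (s n))) \<longlonglongrightarrow> 0"
      using LIMSEQ_subseq_LIMSEQ[OF inv0 s] by (simp add: o_def)
    have "(\<lambda>n. \<Phi> (d (s n))) \<longlonglongrightarrow> \<Phi> w"
      using bounded_linear.tendsto[OF linear_conv_bounded_linear[THEN iffD1, OF \<Phi>] dw]
      by (simp add: o_def)
    moreover have "(\<lambda>n. \<Phi> (d (s n))) \<longlonglongrightarrow> 0"
      by (rule Lim_null_comparison[OF _ invs]) (use \<Phi>d in auto)
    ultimately have \<Phi>w: "\<Phi> w = 0" by (rule LIMSEQ_unique)
    have "\<exists>c\<in>C. dist (K (x n)) c < t n * (1 / real (Suc n))" for n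
    proof -
      have "infdist (K (x n)) C < t n * (1 / real (Suc n))"
        using bound[of n] norm_ge_zero[of "\<Phi> (x n - x0)"] by linarith
      moreover have "C \<noteq> {}" using C by blast
      ultimately show ?thesis
        by (simp add: infdist_notempty cINF_less_iff)
    qed
    then obtain c where c: "\<And>n. c n \<in> C" "\<And>n. dist (K (x n)) (c n) < t n * (1 / real (Suc n))"
      by metis
    define ws where "ws n = (1 / t n) *\<^sub>R (c n - K x0)" for n
    have wsd: "norm (ws n - K (d n)) \<le> 1 / real (Suc n)" for n
    proof -
      have "c n - K (x n) = t n *\<^sub>R (ws n - K (d n))"
        using tpos[of n]
        by (simp add: ws_def xd linear_add[OF K] linear_scale[OF K] scaleR_diff_right)
      then have "t n * norm (ws n - K (d n)) = dist (K (x n)) (c n)"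
        using tpos[of n] by (simp add: dist_norm norm_minus_commute)
      also have "\<dots> \<le> t n * (1 / real (Suc n))" using c(2)[of n] by linarith
      finally show ?thesis using tpos[of n] by (simp only: mult_le_cancel_left_pos)
    qed
    have "(\<lambda>n. ws (s n) - K (d (s n))) \<longlonglongrightarrow> 0"
      by (rule Lim_null_comparison[OF _ invs]) (use wsd in auto)
    moreover have "(\<lambda>n. K (d (s n))) \<longlonglongrightarrow> K w"
      using bounded_linear.tendsto[OF linear_conv_bounded_linear[THEN iffD1, OF K] dw]
      by (simp add: o_def)
    ultimately have wslim: "(\<lambda>n. ws (s n)) \<longlonglongrightarrow> K w"
      using tendsto_add by fastforce
    have "K x0 + t (s n) *\<^sub>R ws (s n) \<in> C" for n
      using tpos[of "s n"] c(1)[of "s n"] by (simp add: ws_def)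
    then have "K w \<in> tangent_cone C (K x0)"
      unfolding tangent_cone_def
      using tpos wslim LIMSEQ_subseq_LIMSEQ[OF tlim s]
      by (intro CollectI exI[of _ "\<lambda>n. t (s n)"] exI[of _ "\<lambda>n. ws (s n)"]) (auto simp: o_def)
    then have "w = 0" using ker \<Phi>w by auto
    then show False using w by simp
  qed
  then obtain n where "\<And>x. norm (x - x0) < 1 / real (Suc n) \<Longrightarrow> norm (x - x0) \<le> real (Suc n) * ?R x"
    by blast
  then show thesis by (intro that[of "real (Suc n)" "1 / real (Suc n)"]) auto
qed

section \<open>Perturbed solutions\<close>

lemma S_LS_iff:
  "x \<in> S_LS \<Phi> K g b \<mu> \<longleftrightarrow>
    (\<exists>y\<in>subdifferential g (K x). (1 / \<mu>) *\<^sub>R adjoint \<Phi> (\<Phi> x - b) + adjoint K y = 0)"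
  unfolding S_LS_def by (auto simp: image_iff eq_commute[of 0])

text \<open>Adding the subgradient inequality at \<open>K x\<close> to the growth inequality at \<open>K x0\<close> gives
  \<open>c / 2 * d\<^sup>2 \<le> (y - y0) \<bullet> K h\<close>, where \<open>h = x - x0\<close> and \<open>d\<close> is the distance of \<open>K x\<close> to the
  set of points with subgradient \<open>y0\<close>. The two optimality conditions turn the right-hand side
  into \<open>- norm (\<Phi> h)\<^sup>2 / \<mu>\<close> plus terms bounded by \<open>norm (\<Phi> h)\<close> times the size of the
  perturbation. Both residuals are thereby controlled at once.\<close>

lemma S_LS_residual_estimate:
  fixes \<Phi> :: "'x::euclidean_space \<Rightarrow> 'e::euclidean_space" and K :: "'x \<Rightarrow> 'y::euclidean_space"
  assumes \<Phi>: "linear \<Phi>" and K: "linear K" and \<mu>: "\<mu> > 0" "\<mu>0 > 0"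
    and x: "x \<in> S_LS \<Phi> K g b \<mu>"
    and y0: "y0 \<in> subdifferential g (K x0)"
    and opt: "adjoint K y0 = - ((1 / \<mu>0) *\<^sub>R adjoint \<Phi> (\<Phi> x0 - b0))"
    and growth: "g (K x) \<ge> g (K x0) + ereal (y0 \<bullet> (K x - K x0) + c / 2 * d\<^sup>2)"
  shows "(norm (\<Phi> (x - x0)))\<^sup>2 + \<mu> * (c / 2 * d\<^sup>2) \<le>
    (1 + norm (\<Phi> x0 - b0) / \<mu>0) * (norm (b - b0) + \<bar>\<mu> - \<mu>0\<bar>) * norm (\<Phi> (x - x0))"
proof -
  define h where "h = x - x0"
  define r where "r = \<Phi> x0 - b0"
  obtain y where y: "y \<in> subdifferential g (K x)"
    and yopt: "(1 / \<mu>) *\<^sub>R adjoint \<Phi> (\<Phi> x - b) + adjoint K y = 0"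
    using x by (auto simp: S_LS_iff)
  obtain gx where gx: "g (K x) = ereal gx" using y by (auto simp: subdifferential_def)
  obtain g0 where g0: "g (K x0) = ereal g0" using y0 by (auto simp: subdifferential_def)
  have "g (K x) + ereal (y \<bullet> (K x0 - K x)) \<le> g (K x0)"
    using y by (auto simp: subdifferential_def)
  then have "gx + y \<bullet> (K x0 - K x) \<le> g0" by (simp add: gx g0)
  moreover have "g0 + (y0 \<bullet> (K x - K x0) + c / 2 * d\<^sup>2) \<le> gx" using growth by (simp add: gx g0)
  moreover have "y \<bullet> (K x0 - K x) = - (K h \<bullet> y)" "y0 \<bullet> (K x - K x0) = K h \<bullet> y0"
    by (simp_all add: h_def linear_diff[OF K] inner_diff_left inner_diff_right inner_commute)
  ultimately have mono: "c / 2 * d\<^sup>2 \<le> K h \<bullet> y - K h \<bullet> y0" by linarith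
  have Ky: "K h \<bullet> y = - (\<Phi> h \<bullet> (\<Phi> x - b)) / \<mu>"
  proof -
    have "K h \<bullet> y = h \<bullet> adjoint K y" by (simp add: adjoint_works[OF K])
    also have "adjoint K y = - ((1 / \<mu>) *\<^sub>R adjoint \<Phi> (\<Phi> x - b))"
      using yopt by (simp add: eq_neg_iff_add_eq_0 add.commute)
    also have "h \<bullet> \<dots> = - (\<Phi> h \<bullet> (\<Phi> x - b)) / \<mu>" by (simp add: adjoint_works[OF \<Phi>])
    finally show ?thesis .
  qed
  have Ky0: "K h \<bullet> y0 = - (\<Phi> h \<bullet> r) / \<mu>0"
  proof -
    have "K h \<bullet> y0 = h \<bullet> adjoint K y0" by (simp add: adjoint_works[OF K])
    also have "\<dots> = - (\<Phi> h \<bullet> r) / \<mu>0" by (simp add: opt r_def adjoint_works[OF \<Phi>])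
    finally show ?thesis .
  qed
  have "\<Phi> x - b = \<Phi> h + r - (b - b0)" by (simp add: h_def r_def linear_diff[OF \<Phi>])
  then have split: "\<Phi> h \<bullet> (\<Phi> x - b) = (norm (\<Phi> h))\<^sup>2 + \<Phi> h \<bullet> r - \<Phi> h \<bullet> (b - b0)"
    by (simp add: inner_add_right inner_diff_right power2_norm_eq_inner)
  have "\<mu> * (c / 2 * d\<^sup>2) \<le> \<mu> * (K h \<bullet> y - K h \<bullet> y0)"
    using mono \<mu>(1) by (intro mult_left_mono) auto
  also have "\<dots> = - (norm (\<Phi> h))\<^sup>2 + \<Phi> h \<bullet> (b - b0) + ((\<mu> - \<mu>0) / \<mu>0) * (\<Phi> h \<bullet> r)"
    using \<mu> by (simp add: Ky Ky0 split field_simps)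
  finally have "(norm (\<Phi> h))\<^sup>2 + \<mu> * (c / 2 * d\<^sup>2) \<le>
    \<Phi> h \<bullet> (b - b0) + ((\<mu> - \<mu>0) / \<mu>0) * (\<Phi> h \<bullet> r)" by linarith
  also have "\<dots> \<le> norm (\<Phi> h) * norm (b - b0) + (\<bar>\<mu> - \<mu>0\<bar> / \<mu>0) * (norm (\<Phi> h) * norm r)"
  proof (rule add_mono)
    show "\<Phi> h \<bullet> (b - b0) \<le> norm (\<Phi> h) * norm (b - b0)" by (rule norm_cauchy_schwarz)
    have "((\<mu> - \<mu>0) / \<mu>0) * (\<Phi> h \<bullet> r) \<le> \<bar>((\<mu> - \<mu>0) / \<mu>0) * (\<Phi> h \<bullet> r)\<bar>" by (rule abs_ge_self)
    also have "\<dots> = (\<bar>\<mu> - \<mu>0\<bar> / \<mu>0) * \<bar>\<Phi> h \<bullet> r\<bar>" using \<mu> by (simp add: abs_mult)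
    also have "\<dots> \<le> (\<bar>\<mu> - \<mu>0\<bar> / \<mu>0) * (norm (\<Phi> h) * norm r)"
      using \<mu> by (intro mult_left_mono Cauchy_Schwarz_ineq2) auto
    finally show "((\<mu> - \<mu>0) / \<mu>0) * (\<Phi> h \<bullet> r) \<le> (\<bar>\<mu> - \<mu>0\<bar> / \<mu>0) * (norm (\<Phi> h) * norm r)" .
  qed
  also have "\<dots> = (norm (b - b0) + (norm r / \<mu>0) * \<bar>\<mu> - \<mu>0\<bar>) * norm (\<Phi> h)"
    by (simp add: field_simps)
  also have "\<dots> \<le> ((1 + norm r / \<mu>0) * (norm (b - b0) + \<bar>\<mu> - \<mu>0\<bar>)) * norm (\<Phi> h)"
    using \<mu> by (intro mult_right_mono) (simp_all add: distrib_left distrib_right)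
  finally show ?thesis by (simp add: h_def r_def)
qed

lemma S_LS_residual_bound:
  fixes \<Phi> :: "'x::euclidean_space \<Rightarrow> 'e::euclidean_space" and K :: "'x \<Rightarrow> 'y::euclidean_space"
  assumes \<Phi>: "linear \<Phi>" and K: "linear K" and \<mu>0: "\<mu>0 > 0"
    and opt: "adjoint K y0 = - ((1 / \<mu>0) *\<^sub>R adjoint \<Phi> (\<Phi> x0 - b0))"
    and growth: "quadratic_growth g (K x0) y0"
  obtains B \<epsilon> where "B > 0" "\<epsilon> > 0"
    "\<And>b \<mu> x. x \<in> S_LS \<Phi> K g b \<mu> \<Longrightarrow> \<mu> > \<mu>0 / 2 \<Longrightarrow> norm (K x - K x0) < \<epsilon> \<Longrightarrow>
      norm (\<Phi> (x - x0)) + infdist (K x) {u. y0 \<in> subdifferential g u} \<le> B * (norm (b - b0) + \<bar>\<mu> - \<mu>0\<bar>)"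
proof -
  have y0: "y0 \<in> subdifferential g (K x0)" using growth by (simp add: quadratic_growth_def)
  let ?d = "\<lambda>u. infdist u {u. y0 \<in> subdifferential g u}"
  obtain c \<epsilon> where c: "c > 0" and \<epsilon>: "\<epsilon> > 0" and gr: "\<And>u. norm (u - K x0) < \<epsilon> \<Longrightarrow>
      g u \<ge> g (K x0) + ereal (y0 \<bullet> (u - K x0) + c / 2 * (?d u)\<^sup>2)"
    using growth by (auto simp: quadratic_growth_def)
  \<comment> \<open>The two constants come from solving the residual estimate for \<open>norm (\<Phi> (x - x0))\<close> and then,
    with \<open>\<mu> > \<mu>0 / 2\<close>, for the distance.\<close>
  define A where "A = 1 + norm (\<Phi> x0 - b0) / \<mu>0"
  have A: "A > 0" using \<mu>0 by (auto simp: A_def intro!: add_pos_nonneg)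
  define D where "D = A * sqrt (4 / (\<mu>0 * c))"
  have D: "D > 0" using A \<mu>0 c by (simp add: D_def)
  show thesis
  proof (rule that[of "A + D" \<epsilon>])
    fix b \<mu> x assume x: "x \<in> S_LS \<Phi> K g b \<mu>" and \<mu>: "\<mu> > \<mu>0 / 2" and near: "norm (K x - K x0) < \<epsilon>"
    define \<delta> where "\<delta> = norm (b - b0) + \<bar>\<mu> - \<mu>0\<bar>"
    have \<delta>: "\<delta> \<ge> 0" by (simp add: \<delta>_def)
    define p where "p = norm (\<Phi> (x - x0))"
    define d where "d = ?d (K x)"
    have p: "p \<ge> 0" and d: "d \<ge> 0" by (simp_all add: p_def d_def infdist_nonneg)
    have \<mu>pos: "\<mu> > 0" using \<mu> \<mu>0 by linarith
    have est: "p\<^sup>2 + \<mu> * (c / 2 * d\<^sup>2) \<le> A * \<delta> * p"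
      using S_LS_residual_estimate[OF \<Phi> K \<mu>pos \<mu>0 x y0 opt gr[OF near]]
      by (simp add: p_def d_def A_def \<delta>_def)
    have "0 \<le> \<mu> * (c / 2 * d\<^sup>2)" using \<mu>pos c by simp
    with est have "p * p \<le> (A * \<delta>) * p" by (simp add: power2_eq_square)
    then have pb: "p \<le> A * \<delta>"
      using p A \<delta> by (cases "p = 0") (auto simp: mult_le_cancel_right)
    have "(\<mu>0 / 2) * (c / 2 * d\<^sup>2) \<le> \<mu> * (c / 2 * d\<^sup>2)"
      using \<mu> c by (intro mult_right_mono) auto
    also have "\<dots> \<le> A * \<delta> * p" using est zero_le_power2[of p] by linarith
    also have "\<dots> \<le> A * \<delta> * (A * \<delta>)" using pb A \<delta> by (intro mult_left_mono) auto
    finally have "d\<^sup>2 \<le> (A * \<delta>)\<^sup>2 * (4 / (\<mu>0 * c))"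
      using \<mu>0 c by (simp add: field_simps power2_eq_square)
    also have "\<dots> = (D * \<delta>)\<^sup>2"
      using \<mu>0 c by (simp add: D_def power_mult_distrib)
    finally have "d \<le> D * \<delta>" by (rule power2_le_imp_le) (use D \<delta> in simp)
    with pb show "norm (\<Phi> (x - x0)) + ?d (K x) \<le> (A + D) * (norm (b - b0) + \<bar>\<mu> - \<mu>0\<bar>)"
      by (simp add: p_def d_def \<delta>_def distrib_right)
  qed (use A D \<epsilon> in auto)
qed

section \<open>Isolated calmness\<close>

text \<open>A direction \<open>w\<close> in the kernel of \<open>\<Phi>\<close> with \<open>K w\<close> tangent to \<open>C \<inter> range K\<close> produces points
  \<open>x0 + t\<^sub>k w\<^sub>k\<close>, \<open>w\<^sub>k \<rightarrow> w\<close>, at which \<open>y0\<close> is still a subgradient. They solve the problem for the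
  datum \<open>b0 + t\<^sub>k \<Phi> w\<^sub>k\<close>, for which the residual is unchanged. The perturbation is \<open>o(t\<^sub>k)\<close>
  because \<open>\<Phi> w = 0\<close>, so calmness forces \<open>w = 0\<close>.\<close>

lemma isolated_calm_imp_kernel_trivial:
  fixes \<Phi> :: "'x::euclidean_space \<Rightarrow> 'e::euclidean_space" and K :: "'x \<Rightarrow> 'y::euclidean_space"
  assumes \<Phi>: "linear \<Phi>" and K: "linear K"
    and y0: "y0 \<in> subdifferential g (K x0)"
    and opt: "adjoint K y0 = - ((1 / \<mu>0) *\<^sub>R adjoint \<Phi> (\<Phi> x0 - b0))"
    and calm: "isolated_calm (S_LS \<Phi> K g) b0 \<mu>0 x0"
  shows "{x. \<Phi> x = 0} \<inter>
    K -` tangent_cone ({u. y0 \<in> subdifferential g u} \<inter> range K) (K x0) = {0}"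
    (is "?L \<inter> K -` tangent_cone ?C _ = _")
proof
  have "0 \<in> tangent_cone ?C (K x0)" using y0 by (intro zero_in_tangent_cone) auto
  then show "{0} \<subseteq> ?L \<inter> K -` tangent_cone ?C (K x0)"
    by (simp add: linear_0[OF \<Phi>] linear_0[OF K])
  show "?L \<inter> K -` tangent_cone ?C (K x0) \<subseteq> {0}"
  proof
    fix w assume "w \<in> ?L \<inter> K -` tangent_cone ?C (K x0)"
    then obtain t vs where \<Phi>w: "\<Phi> w = 0" and t: "\<And>k::nat. t k > (0::real)" "t \<longlonglongrightarrow> 0"
      and vs: "vs \<longlonglongrightarrow> K w" "\<And>k. K x0 + t k *\<^sub>R vs k \<in> ?C"
      unfolding tangent_cone_def by blast
    obtain \<kappa> U V M where \<kappa>: "\<kappa> > 0" and U: "open U" "x0 \<in> U" and V: "open V" "b0 \<in> V"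
      and M: "\<mu>0 \<in> M"
      and cl: "\<And>b \<mu> x. b \<in> V \<Longrightarrow> \<mu> \<in> M \<Longrightarrow> x \<in> S_LS \<Phi> K g b \<mu> \<inter> U \<Longrightarrow>
        norm (x - x0) \<le> \<kappa> * (norm (b - b0) + \<bar>\<mu> - \<mu>0\<bar>)"
      using calm unfolding isolated_calm_def by metis
    have vr: "vs k \<in> range K" for k
    proof -
      obtain a where "K x0 + t k *\<^sub>R vs k = K a" using vs(2)[of k] by blast
      then have "t k *\<^sub>R vs k = K (a - x0)" by (simp add: linear_diff[OF K] algebra_simps)
      then have "vs k = K ((1 / t k) *\<^sub>R (a - x0))"
        using t(1)[of k] by (simp add: linear_scale[OF K] flip: \<open>t k *\<^sub>R vs k = K (a - x0)\<close>)
      then show ?thesis by blast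
    qed
    \<comment> \<open>A linear right inverse of \<open>K\<close> on its range lifts the converging directions.\<close>
    obtain J where J: "linear J" "\<And>v. v \<in> range K \<Longrightarrow> K (J v) = v"
      using linear_exists_right_inverse_on[OF K subspace_UNIV] by blast
    define ws where "ws k = w + J (vs k - K w)" for k
    have Kws: "K (ws k) = vs k" for k
    proof -
      have "vs k - K w \<in> range K"
        using vr[of k] subspace_diff[OF linear_subspace_image[OF K subspace_UNIV]] by blast
      then show ?thesis by (simp add: ws_def linear_add[OF K] J(2))
    qed
    have wslim: "ws \<longlonglongrightarrow> w"
    proof -
      have "(\<lambda>k. w + J (vs k - K w)) \<longlonglongrightarrow> w + J (K w - K w)"
        by (intro tendsto_intros bounded_linear.tendsto[OF linear_conv_bounded_linear[THEN iffD1, OF J(1)]] vs)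
      then show ?thesis by (simp add: ws_def[abs_def] linear_0[OF J(1)])
    qed
    have \<Phi>lim: "(\<lambda>k. \<Phi> (ws k)) \<longlonglongrightarrow> 0"
      using bounded_linear.tendsto[OF linear_conv_bounded_linear[THEN iffD1, OF \<Phi>] wslim] \<Phi>w by simp
    define x where "x k = x0 + t k *\<^sub>R ws k" for k
    define b where "b k = b0 + t k *\<^sub>R \<Phi> (ws k)" for k
    have "x \<longlonglongrightarrow> x0 + 0 *\<^sub>R w" unfolding x_def[abs_def] by (intro tendsto_intros t wslim)
    then have xU: "eventually (\<lambda>k. x k \<in> U) sequentially"
      using topological_tendstoD U by fastforce
    have "b \<longlonglongrightarrow> b0 + 0 *\<^sub>R 0" unfolding b_def[abs_def] by (intro tendsto_intros t \<Phi>lim)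
    then have bV: "eventually (\<lambda>k. b k \<in> V) sequentially"
      using topological_tendstoD V by fastforce
    have xS: "x k \<in> S_LS \<Phi> K g (b k) \<mu>0" for k
    proof -
      have "K (x k) = K x0 + t k *\<^sub>R vs k"
        by (simp add: x_def linear_add[OF K] linear_scale[OF K] Kws)
      then have "y0 \<in> subdifferential g (K (x k))" using vs(2)[of k] by simp
      moreover have "\<Phi> (x k) - b k = \<Phi> x0 - b0"
        by (simp add: x_def b_def linear_add[OF \<Phi>] linear_scale[OF \<Phi>])
      ultimately show ?thesis using opt by (auto simp: S_LS_iff intro!: bexI[of _ y0])
    qed
    have "eventually (\<lambda>k. norm (ws k) \<le> \<kappa> * norm (\<Phi> (ws k))) sequentially"
      using xU bV
    proof eventually_elim
      case (elim k)
      have "norm (x k - x0) \<le> \<kappa> * (norm (b k - b0) + \<bar>\<mu>0 - \<mu>0\<bar>)"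
        using cl[of "b k" \<mu>0 "x k"] elim M xS by blast
      then have "t k * norm (ws k) \<le> t k * (\<kappa> * norm (\<Phi> (ws k)))"
        using t(1)[of k] by (simp add: x_def b_def mult.left_commute)
      then show ?case using t(1)[of k] by (simp only: mult_le_cancel_left_pos)
    qed
    then have "norm w \<le> \<kappa> * norm (0::'e)"
      by (intro tendsto_le[OF _ tendsto_mult[OF tendsto_const tendsto_norm[OF \<Phi>lim]]
            tendsto_norm[OF wslim]]) auto
    then show "w \<in> {0}" by simp
  qed
qed

lemma kernel_trivial_imp_isolated_calm:
  fixes \<Phi> :: "'x::euclidean_space \<Rightarrow> 'e::euclidean_space" and K :: "'x \<Rightarrow> 'y::euclidean_space"
  assumes \<Phi>: "linear \<Phi>" and K: "linear K" and \<mu>0: "\<mu>0 > 0"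
    and x0: "x0 \<in> S_LS \<Phi> K g b0 \<mu>0"
    and opt: "adjoint K y0 = - ((1 / \<mu>0) *\<^sub>R adjoint \<Phi> (\<Phi> x0 - b0))"
    and growth: "quadratic_growth g (K x0) y0"
    and ker: "{x. \<Phi> x = 0} \<inter> K -` tangent_cone {u. y0 \<in> subdifferential g u} (K x0) = {0}"
  shows "isolated_calm (S_LS \<Phi> K g) b0 \<mu>0 x0"
proof -
  let ?C = "{u. y0 \<in> subdifferential g u}"
  have "K x0 \<in> ?C" using growth by (simp add: quadratic_growth_def)
  from error_bound_of_tangent_cone[OF \<Phi> K this equalityD1[OF ker]]
  obtain \<kappa> \<rho> where \<kappa>: "\<kappa> > 0" and \<rho>: "\<rho> > 0" and err: "\<And>x. norm (x - x0) < \<rho> \<Longrightarrow>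
      norm (x - x0) \<le> \<kappa> * (norm (\<Phi> (x - x0)) + infdist (K x) ?C)"
    by blast
  obtain B \<epsilon> where B: "B > 0" and \<epsilon>: "\<epsilon> > 0"
    and res: "\<And>b \<mu> x. x \<in> S_LS \<Phi> K g b \<mu> \<Longrightarrow> \<mu> > \<mu>0 / 2 \<Longrightarrow> norm (K x - K x0) < \<epsilon> \<Longrightarrow>
      norm (\<Phi> (x - x0)) + infdist (K x) ?C \<le> B * (norm (b - b0) + \<bar>\<mu> - \<mu>0\<bar>)"
    using S_LS_residual_bound[OF \<Phi> K \<mu>0 opt growth] by blast
  have contK: "continuous_on UNIV K" by (rule linear_continuous_on)
      (use K in \<open>simp add: linear_conv_bounded_linear\<close>)
  define U where "U = ball x0 \<rho> \<inter> K -` ball (K x0) \<epsilon>"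
  have U: "open U" "x0 \<in> U"
    using contK \<rho> \<epsilon> by (auto simp: U_def intro!: open_Int open_vimage)
  have "norm (x - x0) \<le> (\<kappa> * B) * (norm (b - b0) + \<bar>\<mu> - \<mu>0\<bar>)"
    if "\<mu> \<in> {\<mu>0 / 2<..}" "x \<in> S_LS \<Phi> K g b \<mu> \<inter> U" for b \<mu> x
  proof -
    have "norm (x - x0) \<le> \<kappa> * (norm (\<Phi> (x - x0)) + infdist (K x) ?C)"
      using that by (intro err) (simp add: U_def dist_norm norm_minus_commute)
    also have "\<dots> \<le> \<kappa> * (B * (norm (b - b0) + \<bar>\<mu> - \<mu>0\<bar>))"
      using that \<kappa> by (intro mult_left_mono res) (auto simp: U_def dist_norm norm_minus_commute)
    finally show ?thesis by (simp add: mult.assoc)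
  qed
  then show ?thesis
    unfolding isolated_calm_def using x0 \<kappa> B U \<mu>0
    by (intro conjI exI[of _ "\<kappa> * B"] exI[of _ U] exI[of _ UNIV] exI[of _ "{\<mu>0 / 2<..}"]) auto
qed

theorem theorem4p3:
  fixes \<Phi> :: "'x::euclidean_space \<Rightarrow> 'e::euclidean_space"
    and K :: "'x \<Rightarrow> 'y::euclidean_space"
    and g :: "'y \<Rightarrow> ereal"
    and bbar :: 'e and \<mu>bar :: real and xbar :: 'x and ybar :: 'y
  assumes "linear \<Phi>" and "linear K"
    and "proper_fun g" and "lower_semicontinuous g" and "convex_fun g"
    and "\<mu>bar > 0"
    and "xbar \<in> S_LS \<Phi> K g bbar \<mu>bar"
    and "ybar \<in> subdifferential g (K xbar)"
    and "adjoint K ybar = - ((1 / \<mu>bar) *\<^sub>R adjoint \<Phi> (\<Phi> xbar - bbar))"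
    and RCQ: "0 \<in> interior {K xbar + u - v | u v. u \<in> range K \<and> v \<in> eff_dom g}"
  shows
    "(isolated_calm (S_LS \<Phi> K g) bbar \<mu>bar xbar \<longrightarrow>
        {x. \<Phi> x = 0} \<inter>
          K -` tangent_cone (subdifferential (fenchel_conjugate g) ybar \<inter> range K) (K xbar) = {0})
     \<and>
     (quadratic_growth g (K xbar) ybar \<longrightarrow>
        {x. \<Phi> x = 0} \<inter>
          K -` tangent_cone (subdifferential (fenchel_conjugate g) ybar) (K xbar) = {0} \<longrightarrow>
        isolated_calm (S_LS \<Phi> K g) bbar \<mu>bar xbar)
     \<and>
     (quadratic_growth g (K xbar) ybar \<longrightarrow>
        polyhedron (subdifferential (fenchel_conjugate g) ybar) \<or>
          range K \<inter> rel_interior (subdifferential (fenchel_conjugate g) ybar) \<noteq> {} \<longrightarrow>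
        (isolated_calm (S_LS \<Phi> K g) bbar \<mu>bar xbar \<longleftrightarrow>
          {x. \<Phi> x = 0} \<inter>
            K -` tangent_cone (subdifferential (fenchel_conjugate g) ybar) (K xbar) = {0}))"
proof -
  let ?C = "{u. ybar \<in> subdifferential g u}"
  let ?D = "subdifferential (fenchel_conjugate g) ybar"
  let ?N = "{x. \<Phi> x = 0}"
  have D: "?D = ?C" using subdifferential_fenchel_conjugate assms(3-5) by blast
  have R: "subspace (range K)" using linear_subspace_image[OF assms(2) subspace_UNIV] .
  have necessary: "?N \<inter> K -` tangent_cone (?D \<inter> range K) (K xbar) = {0}"
    if "isolated_calm (S_LS \<Phi> K g) bbar \<mu>bar xbar"
    using isolated_calm_imp_kernel_trivial[OF assms(1,2,8,9) that] by (simp add: D)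
  have sufficient: "isolated_calm (S_LS \<Phi> K g) bbar \<mu>bar xbar"
    if "quadratic_growth g (K xbar) ybar" "?N \<inter> K -` tangent_cone ?D (K xbar) = {0}"
    using kernel_trivial_imp_isolated_calm[OF assms(1,2,6,7,9) that(1)] that(2) by (simp add: D)
  have cones: "K -` tangent_cone (?D \<inter> range K) (K xbar) = K -` tangent_cone ?D (K xbar)"
    if "polyhedron ?D \<or> range K \<inter> rel_interior ?D \<noteq> {}"
  proof -
    have u: "K xbar \<in> ?D" "K xbar \<in> range K" using assms(8) by (auto simp: D)
    have "tangent_cone ?D (K xbar) \<inter> range K \<subseteq> tangent_cone (?D \<inter> range K) (K xbar)"
      using that
    proof
      assume "polyhedron ?D"
      then show ?thesis using R u by (rule tangent_cone_polyhedron_Int_subspace)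
    next
      assume "range K \<inter> rel_interior ?D \<noteq> {}"
      then obtain z where "z \<in> range K" "z \<in> rel_interior ?D" by blast
      then show ?thesis
        using tangent_cone_rel_interior_Int_subspace[OF convex_subdifferential R u] by blast
    qed
    moreover have "tangent_cone (?D \<inter> range K) (K xbar) \<subseteq> tangent_cone ?D (K xbar)"
      by (intro tangent_cone_mono) auto
    ultimately show ?thesis by blast
  qed
  show ?thesis using necessary sufficient cones by metis
qed

end
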